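(* As formal power series in $u$, \[ \sum_{n=0}^\infty P_{n}^{(\mathrm{lpk},\mathrm{ilpk})}(s,t) u^n = \frac{1}{\sqrt{1-(1-s)(1-t)u^2}}\sum_{k=0}^\infty \frac{1}{k!} \left(\frac{L\big(\sqrt{(1-s)(1-t)}\,u\big)}{\sqrt{(1-s)(1-t)}}\right)^{k} P_{k}^{\mathrm{lpk}}(s)P_{k}^{\mathrm{lpk}}(t), \] where $L(u)=\frac12\log\frac{1+u}{1-u}=\sum_{m\ge1}\frac{u^{2m-1}}{2m-1}$.
   Context: $\mathfrak{S}_n$ is the symmetric group on $[n]$. For $\pi\in\mathfrak{S}_n$, $i$ with $2\le i\le n-1$ is a peak if $\pi(i-1)<\pi(i)>\pi(i+1)$; $i\in[n-1]$ is a left peak if $i$ is a peak, or if $i=1$ and $\pi(1)>\pi(2)$; $\mathrm{lpk}(\pi)$ is the number of left peaks and $\mathrm{ilpk}(\pi)=\mathrm{lpk}(\pi^{-1})$. $P_{n}^{(\mathrm{lpk},\mathrm{ilpk})}(s,t)=\sum_{\pi\in\mathfrak{S}_{n}}s^{\mathrm{lpk}(\pi)}t^{\mathrm{ilpk}(\pi)}$ and $P_n^{\mathrm{lpk}}(t)=\sum_{\pi\in\mathfrak{S}_n}t^{\mathrm{lpk}(\pi)}$, with both equal to $1$ for $n=0$. *)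

theory Defs
  imports
    "HOL-Combinatorics.Permutations"
    "HOL-Computational_Algebra.Formal_Power_Series"
begin

text \<open>
  Permutations of \<open>[n]\<close> are functions \<open>p\<close> with \<open>p permutes {1..n}\<close>.  Such functions fix every
  number outside \<open>{1..n}\<close>, so \<open>n\<close> has to be passed separately; the group inverse is \<open>inv p\<close>.
\<close>

definition is_peak :: "nat \<Rightarrow> (nat \<Rightarrow> nat) \<Rightarrow> nat \<Rightarrow> bool" where
  "is_peak n p i \<longleftrightarrow> 2 \<le> i \<and> i \<le> n - 1 \<and> p (i - 1) < p i \<and> p i > p (i + 1)"

definition left_peaks :: "nat \<Rightarrow> (nat \<Rightarrow> nat) \<Rightarrow> nat set" where
  "left_peaks n p = {i \<in> {1..n - 1}. is_peak n p i \<or> (i = 1 \<and> p 1 > p 2)}"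

definition lpk :: "nat \<Rightarrow> (nat \<Rightarrow> nat) \<Rightarrow> nat" where
  "lpk n p = card (left_peaks n p)"

definition ilpk :: "nat \<Rightarrow> (nat \<Rightarrow> nat) \<Rightarrow> nat" where
  "ilpk n p = lpk n (inv p)"

text \<open>
  The polynomials are given through their values in an arbitrary commutative ring; indeterminates
  \<open>s\<close>, \<open>t\<close> are the instance where the ring is an extension of the polynomial ring in \<open>s\<close>, \<open>t\<close>.
\<close>

definition P_lpk_ilpk :: "nat \<Rightarrow> 'a::comm_ring_1 \<Rightarrow> 'a \<Rightarrow> 'a" where
  "P_lpk_ilpk n s t = (\<Sum>p | p permutes {1..n}. s ^ lpk n p * t ^ ilpk n p)"

definition P_lpk :: "nat \<Rightarrow> 'a::comm_ring_1 \<Rightarrow> 'a" where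
  "P_lpk n t = (\<Sum>p | p permutes {1..n}. t ^ lpk n p)"

definition L_fps :: "'a::field_char_0 fps" where
  "L_fps = Abs_fps (\<lambda>n. if odd n then 1 / of_nat n else 0)"

lemma L_fps_eq_log:
  "L_fps = fps_const (1 / 2 :: 'a::field_char_0) *
             (fps_ln 1 oo ((1 + fps_X) / (1 - fps_X) - 1))"
  (is "_ = ?R")
proof -
  define q :: "'a fps" where "q = (1 + fps_X) * inverse (1 - fps_X)"
  have q: "(1 + fps_X) / (1 - fps_X) = q"
    by (simp add: q_def fps_divide_unit)
  have q1: "q - 1 = 2 * fps_X * inverse (1 - fps_X)"
  proof -
    have "(1 - fps_X) * inverse (1 - fps_X :: 'a fps) = 1"
      by (simp add: inverse_mult_eq_1')
    thus ?thesis unfolding q_def by algebra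
  qed
  have i: "inverse (1 - fps_X) * (1 - fps_X :: 'a fps) = 1"
    by (simp add: inverse_mult_eq_1)
  have q0: "fps_nth (q - 1) 0 = 0" by (simp add: q1)
  have dq: "fps_deriv (q - 1) = 2 * inverse (1 - fps_X) ^ 2"
    unfolding q_def using i
    by (simp add: fps_inverse_deriv) algebra
  have dln: "fps_deriv (fps_ln 1 oo (q - 1)) = (inverse (1 + fps_X) oo (q - 1)) * fps_deriv (q - 1)"
    using q0 by (simp add: fps_compose_deriv fps_ln_deriv fps_divide_unit)
  have c: "(inverse (1 + fps_X) oo (q - 1)) * q = 1"
  proof -
    have "(inverse (1 + fps_X :: 'a fps) * (1 + fps_X)) oo (q - 1) = 1 oo (q - 1)"
      by (simp add: inverse_mult_eq_1)
    thus ?thesis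
      using q0 by (simp add: fps_compose_mult_distrib fps_compose_add_distrib)
  qed
  have dR: "fps_deriv (fps_ln 1 oo (q - 1)) * (1 - fps_X ^ 2) = 2"
  proof -
    have qq: "q * (1 - fps_X) = 1 + fps_X"
      unfolding q_def using i by algebra
    show ?thesis unfolding dln dq using c qq i by algebra
  qed
  have dL: "fps_deriv L_fps * (1 - fps_X ^ 2) = (1 :: 'a fps)"
  proof (rule fps_ext)
    fix n
    have d: "fps_nth (fps_deriv L_fps) m = (if even m then 1 else 0 :: 'a)" for m
      by (simp add: L_fps_def del: of_nat_Suc)
    have "fps_nth (fps_deriv L_fps * (1 - fps_X ^ 2)) n =
          fps_nth (fps_deriv L_fps) n - (if n < 2 then 0 else fps_nth (fps_deriv L_fps :: 'a fps) (n - 2))"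
      by (simp only: right_diff_distrib fps_sub_nth fps_X_power_mult_right_nth mult_1_right)
    also have "\<dots> = fps_nth 1 n"
      unfolding d by (auto simp: less_2_cases_iff)
    finally show "fps_nth (fps_deriv L_fps * (1 - fps_X ^ 2)) n = fps_nth (1 :: 'a fps) n" .
  qed
  have "fps_deriv (L_fps - ?R) * (1 - fps_X ^ 2) = 0"
  proof -
    have "fps_deriv ?R * (1 - fps_X ^ 2) = fps_const (1/2) * (2 :: 'a fps)"
      unfolding q using dR by (simp add: mult.assoc)
    also have "\<dots> = 1" by (simp add: fps_eq_iff numeral_fps_const)
    finally show ?thesis using dL by (simp only: fps_deriv_sub left_diff_distrib) simp
  qed
  moreover have "1 - fps_X ^ 2 \<noteq> (0 :: 'a fps)"
    by (auto simp: fps_eq_iff intro!: exI[of _ 0])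
  ultimately have "fps_deriv (L_fps - ?R) = 0" by simp
  moreover have "fps_nth (L_fps - ?R) 0 = 0"
    by (simp add: L_fps_def)
  ultimately have "L_fps - ?R = 0" by (metis fps_deriv_eq_0_iff fps_const_0_eq_0)
  thus ?thesis by simp
qed

text \<open>
  \<open>L_quot r\<close> is \<open>L(r u) / r\<close>.  The coefficient of \<open>u\<^sup>n\<close> for odd \<open>n\<close> is \<open>r\<^sup>n\<^sup>-\<^sup>1 / n\<close>; at \<open>r = 0\<close> we take the
  value of this series there, namely \<open>u\<close>, because division by zero in \<open>fps\<close> would yield \<open>0\<close>.
\<close>

definition L_quot :: "'a::field_char_0 \<Rightarrow> 'a fps" where
  "L_quot r = (if r = 0 then fps_X
               else (L_fps oo (fps_const r * fps_X)) / fps_const r)"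

lemma L_quot_nth: "fps_nth (L_quot r) n = (if odd n then r ^ (n - 1) / of_nat n else 0)"
proof (cases "r = 0")
  case True
  thus ?thesis by (auto simp: L_quot_def power_0_left elim!: oddE)
next
  case False
  have "fps_nth (L_quot r) n = r ^ n * fps_nth L_fps n / r"
    using False by (simp add: L_quot_def fps_divide_unit fps_const_inverse fps_compose_linear
        divide_inverse)
  thus ?thesis
    using False by (auto simp: L_fps_def elim!: oddE)
qed

text \<open>
  The square root with constant term \<open>1\<close>: the first argument of \<^const>\<open>fps_radical\<close> supplies the root
  of the constant coefficient, so this is meant for series with constant coefficient \<open>1\<close>.
\<close>

abbreviation fps_sqrt1 :: "'a::field_char_0 fps \<Rightarrow> 'a fps" where
  "fps_sqrt1 f \<equiv> fps_radical (\<lambda>_ _. 1) 2 f"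

end

theory Submission
  imports Defs "HOL-Computational_Algebra.Formal_Laurent_Series"
begin

text \<open>
  Let \<open>F\<^sub>p(M)\<close> be the number of left enriched \<open>P\<close>-partitions of a permutation \<open>p\<close> of \<open>[n]\<close> with \<open>M\<close>
  letters.  Building them up position by position gives, for odd \<open>M = 2k + 1\<close>,
  \<open>\<Sum>\<^sub>k F\<^sub>p(2k+1) x\<^sup>k = v\<^sup>n (1 - v\<^sup>-\<^sup>2)\<^sup>l\<^sup>p\<^sup>k / (1 - x)\<close> with \<open>v = (1 + x)/(1 - x)\<close>, so
  \<open>F\<^sub>p = \<Sum>\<^sub>l (-1)\<^sup>l (lpk p choose l) D\<^bsub>n-2l\<^esub>\<close>, where \<open>D\<^sub>i(2k+1)\<close> is the Delannoy number
  of \<open>i\<close> and \<open>k\<close> and belongs to the identity of \<open>[i]\<close>.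

  Standardizing words yields \<open>\<Sum>\<^sub>p F\<^sub>p(M) = M\<^sup>n\<close>, and standardizing pairs of words yields
  \<open>\<Sum>\<^sub>p F\<^sub>p(M) F\<^bsub>inv p\<^esub>(N) = D\<^sub>n(MN)\<close> for odd \<open>M\<close>, \<open>N\<close>.  On the other hand
  \<open>\<Sum>\<^sub>n D\<^sub>n(N) u\<^sup>n = exp(N L(u)) / sqrt(1 - u\<^sup>2)\<close>, so that \<open>D\<^sub>n(MN) = \<Sum>\<^sub>m d\<^bsub>n,m\<^esub> M\<^sup>m N\<^sup>m\<close> with
  \<open>d\<^bsub>n,m\<^esub>\<close> the coefficient of \<open>u\<^sup>n\<close> in \<open>L(u)\<^sup>m / (m! sqrt(1 - u\<^sup>2))\<close>.

  As the \<open>D\<^sub>i\<close> are linearly independent, there is a linear functional in \<open>M\<close> with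
  \<open>D\<^bsub>n-2l\<^esub> \<mapsto> (1 - s)\<^sup>l\<close>.  It sends \<open>F\<^sub>p\<close> to \<open>s\<^sup>l\<^sup>p\<^sup>k\<close> and \<open>M\<^bsup>n-2h\<^esup>\<close> to \<open>(1 - s)\<^sup>h P\<^bsub>n-2h\<^esub>(s)\<close>.
  Applying it in \<open>M\<close>, and the analogue for \<open>t\<close> in \<open>N\<close>, gives the coefficient of \<open>u\<^sup>n\<close>.
\<close>

section \<open>Delannoy numbers\<close>

fun delannoy :: "nat \<Rightarrow> nat \<Rightarrow> nat" where
  "delannoy 0 k = 1"
| "delannoy (Suc n) 0 = 1"
| "delannoy (Suc n) (Suc k) = delannoy (Suc n) k + delannoy n (Suc k) + delannoy n k"

lemma delannoy_0_right [simp]: "delannoy n 0 = 1"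
  by (cases n) simp_all

lemma delannoy_commute: "delannoy n k = delannoy k n"
  by (induction n k rule: delannoy.induct) simp_all

definition delannoy_fps :: "nat \<Rightarrow> 'a::comm_ring_1 fps" where
  "delannoy_fps n = Abs_fps (\<lambda>k. of_nat (delannoy n k))"

lemma fps_nth_delannoy_fps [simp]: "fps_nth (delannoy_fps n) k = of_nat (delannoy n k)"
  by (simp add: delannoy_fps_def)

lemma one_minus_fps_X_neq_0: "1 - fps_X \<noteq> (0 :: 'a::comm_ring_1 fps)"
  by (auto simp: fps_eq_iff intro!: exI[of _ 0])

lemma one_plus_fps_X_neq_0: "1 + fps_X \<noteq> (0 :: 'a::comm_ring_1 fps)"
  by (auto simp: fps_eq_iff intro!: exI[of _ 0])

lemma one_minus_fps_X_mult_eqI: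
  fixes f g :: "'a::comm_ring_1 fps"
  assumes "fps_nth f 0 = fps_nth g 0"
    and "\<And>k. fps_nth f (Suc k) - fps_nth f k = fps_nth g (Suc k)"
  shows "(1 - fps_X) * f = g"
proof (rule fps_ext)
  fix n show "fps_nth ((1 - fps_X) * f) n = fps_nth g n"
    using assms by (cases n) (auto simp: algebra_simps)
qed

lemma one_minus_fps_X_mult_delannoy_fps_0:
  "(1 - fps_X) * delannoy_fps 0 = (1 :: 'a::comm_ring_1 fps)"
  by (rule one_minus_fps_X_mult_eqI) simp_all

lemma one_minus_fps_X_mult_delannoy_fps_Suc:
  "(1 - fps_X) * delannoy_fps (Suc n) = (1 + fps_X) * (delannoy_fps n :: 'a::comm_ring_1 fps)"
  by (rule one_minus_fps_X_mult_eqI) (simp_all add: algebra_simps)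

lemma delannoy_fps_mult_power:
  "delannoy_fps n * (1 - fps_X) ^ Suc n = (1 + fps_X :: 'a::comm_ring_1 fps) ^ n"
proof (induction n)
  case 0
  show ?case using one_minus_fps_X_mult_delannoy_fps_0 by (simp add: mult.commute)
next
  case (Suc n)
  have "delannoy_fps (Suc n) * (1 - fps_X) ^ Suc (Suc n) =
      ((1 - fps_X) * delannoy_fps (Suc n)) * (1 - fps_X :: 'a fps) ^ Suc n"
    by (simp add: mult_ac)
  also have "\<dots> = (1 + fps_X) * (delannoy_fps n * (1 - fps_X) ^ Suc n)"
    by (simp only: one_minus_fps_X_mult_delannoy_fps_Suc mult.assoc)
  finally show ?case unfolding Suc.IH by simp
qed

lemma delannoy_fps_diff_mult_power:
  assumes "k \<le> n"
  shows "delannoy_fps (n - k) * (1 - fps_X) ^ Suc n =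
    (1 + fps_X) ^ (n - k) * (1 - fps_X :: 'a::comm_ring_1 fps) ^ k"
proof -
  have "Suc n = Suc (n - k) + k" using assms by simp
  hence "delannoy_fps (n - k) * (1 - fps_X :: 'a fps) ^ Suc n =
      delannoy_fps (n - k) * (1 - fps_X) ^ Suc (n - k) * (1 - fps_X) ^ k"
    by (metis power_add mult.assoc)
  thus ?thesis by (simp only: delannoy_fps_mult_power)
qed

lemma fps_nth_one_minus_X_power_mult_delannoy_fps:
  assumes "i \<le> r" "r \<le> k"
  shows "fps_nth ((1 - fps_X) ^ r * delannoy_fps i) k =
    (if i = r then 2 ^ r else 0 :: 'a::comm_ring_1)"
  using assms
proof (induction r arbitrary: i k)
  case 0
  thus ?case by simp
next
  case (Suc r)
  then obtain l where k: "k = Suc l" "r \<le> l" by (cases k) auto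
  show ?case
  proof (cases i)
    case 0
    have "(1 - fps_X :: 'a fps) ^ Suc r * delannoy_fps 0 =
        (1 - fps_X) * ((1 - fps_X) ^ r * delannoy_fps 0)"
      by (simp add: mult_ac)
    thus ?thesis
      using Suc.IH[of 0 l] Suc.IH[of 0 k] k 0 by (simp add: left_diff_distrib del: power_Suc)
  next
    case (Suc j)
    have "(1 - fps_X :: 'a fps) ^ Suc r * delannoy_fps i =
        (1 - fps_X) ^ r * ((1 - fps_X) * delannoy_fps (Suc j))"
      by (simp add: Suc mult_ac)
    also have "\<dots> = (1 + fps_X) * ((1 - fps_X) ^ r * delannoy_fps j)"
      by (simp only: one_minus_fps_X_mult_delannoy_fps_Suc mult_ac)
    finally show ?thesis
      using Suc.IH[of j l] Suc.IH[of j k] k Suc Suc.prems(1)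
      by (simp add: distrib_right del: power_Suc) simp
  qed
qed

section \<open>The exponential formula for the Delannoy numbers\<close>

lemma fps_sqrt1_unique:
  assumes "f ^ 2 = g" "fps_nth f 0 = (1 :: 'a::field_char_0)"
  shows "fps_sqrt1 g = f"
proof -
  have "fps_nth g 0 = 1" using assms by (auto simp: fps_power_zeroth)
  thus ?thesis
    using radical_unique[of "\<lambda>_ _. 1" 1 g f] assms by (simp add: numeral_2_eq_2)
qed

lemma fps_sqrt1_compose:
  assumes "fps_nth f 0 = (1 :: 'a::field_char_0)" "fps_nth g 0 = 0"
  shows "fps_sqrt1 f oo g = fps_sqrt1 (f oo g)"
  using fps_compose_radical[of g "\<lambda>_ _. 1" 1 f] assms by (simp add: numeral_2_eq_2)

lemma fps_nth_L_fps_0 [simp]: "fps_nth L_fps 0 = 0"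
  by (simp add: L_fps_def)

lemma fps_exp_compose_fps_ln: "fps_exp 1 oo fps_ln 1 = (1 + fps_X :: 'a::field_char_0 fps)"
proof -
  have "(fps_exp 1 - 1) oo fps_ln 1 = (fps_X :: 'a fps)"
    by (simp only: fps_ln_fps_exp_inv one_neq_zero not_False_eq_True fps_inv_fps_exp_compose)
  thus ?thesis by (simp add: fps_compose_sub_distrib algebra_simps)
qed

lemma fps_exp_L_power:
  "(fps_exp 1 oo L_fps) ^ n = fps_exp (of_nat n) oo (L_fps :: 'a::field_char_0 fps)"
  by (simp add: fps_compose_power fps_exp_power_mult)

lemma fps_exp_L_power2_mult:
  "(fps_exp 1 oo L_fps) ^ 2 * (1 - fps_X) = (1 + fps_X :: 'a::field_char_0 fps)"
proof -
  define q :: "'a fps" where "q = (1 + fps_X) / (1 - fps_X)"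
  have q: "q * (1 - fps_X) = 1 + fps_X"
    by (simp add: q_def fps_divide_unit mult.assoc inverse_mult_eq_1)
  have q0: "fps_nth (q - 1) 0 = 0" by (simp add: q_def fps_divide_unit)
  have two_L: "fps_const 2 * L_fps = fps_ln 1 oo (q - 1)"
    by (simp add: L_fps_eq_log q_def flip: mult.assoc)
  have "(fps_exp 1 oo L_fps) ^ 2 = (fps_exp 1 oo (fps_const 2 * fps_X)) oo (L_fps :: 'a fps)"
    by (simp add: fps_exp_L_power)
  also have "\<dots> = fps_exp 1 oo (fps_const 2 * L_fps)"
    by (subst fps_compose_assoc[symmetric])
       (simp_all add: fps_compose_mult_distrib fps_X_fps_compose_startby0)
  also have "\<dots> = (fps_exp 1 oo fps_ln 1) oo (q - 1)"
    using q0 by (simp add: two_L fps_compose_assoc)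
  also have "\<dots> = q"
    using q0
    by (simp add: fps_exp_compose_fps_ln fps_compose_add_distrib fps_X_fps_compose_startby0)
  finally show ?thesis using q by simp
qed

lemma fps_sqrt1_eq_fps_exp_L:
  "fps_sqrt1 (1 - fps_X ^ 2) = (fps_exp 1 oo L_fps) * (1 - fps_X :: 'a::field_char_0 fps)"
proof (rule fps_sqrt1_unique)
  define e :: "'a fps" where "e = fps_exp 1 oo L_fps"
  have "(e * (1 - fps_X)) ^ 2 = (e ^ 2 * (1 - fps_X)) * (1 - fps_X)"
    by (simp add: power2_eq_square mult_ac)
  also have "\<dots> = (1 + fps_X) * (1 - fps_X)"
    by (simp only: e_def fps_exp_L_power2_mult)
  also have "\<dots> = 1 - fps_X ^ 2" by (simp add: power2_eq_square algebra_simps)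
  finally show "((fps_exp 1 oo L_fps) * (1 - fps_X)) ^ 2 = (1 - fps_X ^ 2 :: 'a fps)"
    by (simp only: e_def)
qed simp

lemma delannoy_fps_eq_exp:
  "delannoy_fps k = inverse (fps_sqrt1 (1 - fps_X ^ 2)) *
     (fps_exp (of_nat (2 * k + 1)) oo (L_fps :: 'a::field_char_0 fps))"
proof -
  define e Q :: "'a fps" where "e = fps_exp 1 oo L_fps" and "Q = fps_sqrt1 (1 - fps_X ^ 2)"
  have eA: "e * (1 - fps_X) = Q" unfolding e_def Q_def by (rule fps_sqrt1_eq_fps_exp_L[symmetric])
  have "(1 - fps_X) ^ Suc k * (Q * delannoy_fps k) = Q * (1 + fps_X) ^ k"
    by (simp add: mult_ac del: power_Suc flip: delannoy_fps_mult_power)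
  also have "\<dots> = Q * (e ^ 2 * (1 - fps_X)) ^ k"
    by (simp only: e_def fps_exp_L_power2_mult)
  also have "\<dots> = (1 - fps_X) ^ Suc k * e ^ (2 * k + 1)"
    by (simp add: power_mult_distrib mult_ac flip: power_mult eA)
  finally have "Q * delannoy_fps k = e ^ (2 * k + 1)"
    using one_minus_fps_X_neq_0 by (metis mult_left_cancel power_not_zero)
  moreover have "inverse Q * Q = 1" by (rule inverse_mult_eq_1) (simp add: Q_def)
  ultimately have "delannoy_fps k = inverse Q * e ^ (2 * k + 1)"
    by (metis mult.assoc mult_1)
  thus ?thesis by (simp only: Q_def e_def fps_exp_L_power)
qed

lemma fps_nth_mult_compose:
  fixes f g h :: "'a::comm_ring_1 fps"
  assumes "fps_nth g 0 = 0"
  shows "fps_nth (h * (f oo g)) n = (\<Sum>m\<le>n. fps_nth f m * fps_nth (h * g ^ m) n)"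
proof -
  have "fps_nth (h * (f oo g)) n =
      (\<Sum>i=0..n. fps_nth h i * (\<Sum>m=0..n-i. fps_nth f m * fps_nth (g ^ m) (n - i)))"
    by (simp only: fps_mult_nth fps_compose_nth)
  also have "\<dots> = (\<Sum>i=0..n. fps_nth h i * (\<Sum>m\<le>n. fps_nth f m * fps_nth (g ^ m) (n - i)))"
    using assms by (intro sum.cong arg_cong2[where f = "(*)"] sum.mono_neutral_left refl)
      (auto simp: startsby_zero_power_prefix)
  also have "\<dots> = (\<Sum>m\<le>n. \<Sum>i=0..n. fps_nth h i * (fps_nth f m * fps_nth (g ^ m) (n - i)))"
    by (subst sum.swap) (simp only: sum_distrib_left)
  finally show ?thesis by (simp add: fps_mult_nth sum_distrib_left mult_ac)
qed

lemma fps_compose_sums: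
  fixes f g :: "'a::comm_ring_1 fps"
  assumes "fps_nth g 0 = 0"
  shows "(\<lambda>k. fps_const (fps_nth f k) * g ^ k) sums (f oo g)"
  unfolding sums_def
proof (rule tendsto_fpsI)
  fix n
  have "fps_nth (\<Sum>k<N. fps_const (fps_nth f k) * g ^ k) n = fps_nth (f oo g) n" if "N > n" for N
    unfolding fps_sum_nth fps_compose_nth fps_mult_left_const_nth
    by (rule sum.mono_neutral_right) (use that assms in \<open>auto simp: startsby_zero_power_prefix\<close>)
  thus "eventually (\<lambda>N. fps_nth (\<Sum>k<N. fps_const (fps_nth f k) * g ^ k) n = fps_nth (f oo g) n)
      sequentially"
    by (intro eventually_mono[OF eventually_gt_at_top[of n]])
qed

definition kernel_coeff :: "'a::field_char_0 \<Rightarrow> nat \<Rightarrow> nat \<Rightarrow> 'a" where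
  "kernel_coeff r n m =
     fps_nth (inverse (fps_sqrt1 (1 - fps_const (r ^ 2) * fps_X ^ 2)) * L_quot r ^ m) n / fact m"

lemma L_quot_1: "L_quot 1 = L_fps"
  by (rule fps_ext) (simp add: L_quot_nth L_fps_def)

lemma delannoy_eq_sum_kernel_coeff:
  "of_nat (delannoy n k) =
     (\<Sum>m\<le>n. kernel_coeff 1 n m * (of_nat (2 * k + 1) :: 'a::field_char_0) ^ m)"
proof -
  have "of_nat (delannoy n k) = fps_nth (inverse (fps_sqrt1 (1 - fps_X ^ 2)) *
      (fps_exp (of_nat (2 * k + 1)) oo (L_fps :: 'a fps))) n"
    by (simp only: delannoy_commute[of n] fps_nth_delannoy_fps flip: delannoy_fps_eq_exp)
  also have "\<dots> = (\<Sum>m\<le>n. kernel_coeff 1 n m * of_nat (2 * k + 1) ^ m)"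
    by (simp only: fps_nth_mult_compose fps_nth_L_fps_0)
       (simp add: kernel_coeff_def L_quot_1 mult.commute)
  finally show ?thesis .
qed

lemma fps_nth_compose_const_X_power2:
  "fps_nth (f oo (fps_const c * fps_X ^ 2)) n =
     (if even n then c ^ (n div 2) * fps_nth f (n div 2) else (0 :: 'a::idom))"
proof -
  have "f oo (fps_const c * fps_X ^ 2) = (f oo (fps_const c * fps_X)) oo fps_X ^ 2"
    by (subst fps_compose_assoc[symmetric])
       (simp_all add: fps_compose_mult_distrib fps_X_fps_compose_startby0)
  thus ?thesis by (simp add: fps_nth_compose_X_power)
qed

text \<open>
  Both \<open>L(u)/u\<close> and \<open>1/sqrt(1 - u\<^sup>2)\<close> are power series in \<open>u\<^sup>2\<close>, so \<open>r\<close> enters only through \<open>r\<^sup>2\<close>.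
\<close>

lemma kernel_coeff_scale:
  "kernel_coeff r n m =
     (if m \<le> n \<and> even (n - m) then (r ^ 2) ^ ((n - m) div 2) * kernel_coeff 1 n m else 0)"
proof -
  define T :: "'a fps" where "T = Abs_fps (\<lambda>j. 1 / of_nat (2 * j + 1))"
  define S :: "'a fps" where "S = inverse (fps_sqrt1 (1 - fps_X))"
  have L: "L_quot c = fps_X * (T oo (fps_const (c ^ 2) * fps_X ^ 2))" for c :: 'a
    by (rule fps_ext)
       (auto simp: L_quot_nth fps_nth_compose_const_X_power2 T_def
          simp flip: power_mult elim!: oddE)
  have Q: "inverse (fps_sqrt1 (1 - fps_const (c ^ 2) * fps_X ^ 2)) =
      S oo (fps_const (c ^ 2) * fps_X ^ 2)" for c :: 'a
    by (simp add: S_def fps_inverse_compose fps_sqrt1_compose fps_compose_sub_distrib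
        fps_X_fps_compose_startby0)
  have "inverse (fps_sqrt1 (1 - fps_const (c ^ 2) * fps_X ^ 2)) * L_quot c ^ m =
      fps_X ^ m * ((S * T ^ m) oo (fps_const (c ^ 2) * fps_X ^ 2))" for c :: 'a
    unfolding Q L
    by (simp add: power_mult_distrib fps_compose_power fps_compose_mult_distrib mult_ac)
  hence "kernel_coeff c n m = (if m \<le> n \<and> even (n - m)
      then (c ^ 2) ^ ((n - m) div 2) * fps_nth (S * T ^ m) ((n - m) div 2) / fact m
      else 0)" for c :: 'a
    by (simp add: kernel_coeff_def fps_X_power_mult_nth fps_nth_compose_const_X_power2)
  from this[of r] this[of 1] show ?thesis by (simp del: even_diff_nat)
qed

section \<open>Linear functionals on power series\<close>

lemma (in vector_space) ex_linear_functional_triangular: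
  fixes \<Lambda> :: "nat \<Rightarrow> 'b \<Rightarrow> 'a" and b :: "nat \<Rightarrow> 'b"
  assumes linear: "\<And>r. Vector_Spaces.linear scale (*) (\<Lambda> r)"
    and zero: "\<And>i r. i < r \<Longrightarrow> \<Lambda> r (b i) = 0"
    and nonzero: "\<And>r. \<Lambda> r (b r) \<noteq> 0"
  shows "\<exists>\<Phi>. Vector_Spaces.linear scale (*) \<Phi> \<and> (\<forall>i<n. \<Phi> (b i) = y i)"
proof (induction n)
  case 0
  show ?case using linear by blast
next
  case (Suc n)
  interpret vector_space_pair scale "(*)"
    by unfold_locales (simp_all add: algebra_simps)
  from Suc obtain \<Phi> where \<Phi>: "Vector_Spaces.linear scale (*) \<Phi>" "\<And>i. i < n \<Longrightarrow> \<Phi> (b i) = y i" by blast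
  define c where "c = (y n - \<Phi> (b n)) / \<Lambda> n (b n)"
  have "Vector_Spaces.linear scale (*) (\<lambda>f. \<Phi> f + c * \<Lambda> n f)"
    by (intro linear_compose_add linear_compose_scale_right \<Phi>(1) linear)
  moreover have "\<Phi> (b i) + c * \<Lambda> n (b i) = y i" if "i < Suc n" for i
    using that \<Phi>(2)[of i] zero[of i n] nonzero[of n] by (cases "i = n") (auto simp: c_def)
  ultimately show ?case by blast
qed

interpretation fps_functional: vector_space_pair "\<lambda>c (f :: 'a::field fps). fps_const c * f" "(*)"
  by unfold_locales (simp_all add: algebra_simps flip: fps_const_add fps_const_mult)

abbreviation linear_functional :: "('a::field fps \<Rightarrow> 'a) \<Rightarrow> bool" where
  "linear_functional \<equiv> Vector_Spaces.linear (\<lambda>c f. fps_const c * f) (*)"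

lemma linear_functional_sum_scale:
  assumes "linear_functional \<Phi>"
  shows "\<Phi> (\<Sum>i\<in>A. fps_const (c i) * f i) = (\<Sum>i\<in>A. c i * \<Phi> (f i))"
  by (simp add: fps_functional.linear_sum[OF assms] fps_functional.linear_scale[OF assms])

lemma linear_functional_tensor_cong:
  assumes "linear_functional \<Phi>" "linear_functional \<Psi>"
    and "\<And>k l. (\<Sum>i\<in>I. fps_nth (f i) k * fps_nth (g i) l) =
      (\<Sum>j\<in>J. fps_nth (f' j) k * fps_nth (g' j) l)"
  shows "(\<Sum>i\<in>I. \<Phi> (f i) * \<Psi> (g i)) = (\<Sum>j\<in>J. \<Phi> (f' j) * \<Psi> (g' j))"
proof -
  have "(\<Sum>i\<in>I. fps_nth (f i) k * \<Psi> (g i)) = (\<Sum>j\<in>J. fps_nth (f' j) k * \<Psi> (g' j))" for k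
  proof -
    have "(\<Sum>i\<in>I. fps_const (fps_nth (f i) k) * g i) = (\<Sum>j\<in>J. fps_const (fps_nth (f' j) k) * g' j)"
      by (rule fps_ext) (simp add: fps_sum_nth assms(3))
    thus ?thesis by (simp flip: linear_functional_sum_scale[OF assms(2)])
  qed
  hence "(\<Sum>i\<in>I. fps_const (\<Psi> (g i)) * f i) = (\<Sum>j\<in>J. fps_const (\<Psi> (g' j)) * f' j)"
    by (intro fps_ext) (simp add: fps_sum_nth mult.commute)
  hence "(\<Sum>i\<in>I. \<Psi> (g i) * \<Phi> (f i)) = (\<Sum>j\<in>J. \<Psi> (g' j) * \<Phi> (f' j))"
    by (simp flip: linear_functional_sum_scale[OF assms(1)])
  thus ?thesis by (simp add: mult.commute)
qed

lemma linear_functional_fps_nth_mult: "linear_functional (\<lambda>f. fps_nth (h * f) n)"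
  unfolding Vector_Spaces.linear_iff
  by (simp add: fps_functional.vs1.vector_space_axioms fps_functional.vs2.vector_space_axioms
      distrib_left mult.left_commute[of h])

lemma ex_linear_functional_delannoy:
  fixes y :: "nat \<Rightarrow> 'a::field_char_0"
  obtains \<Phi> where "linear_functional \<Phi>" "\<And>i. i \<le> n \<Longrightarrow> \<Phi> (delannoy_fps i) = y i"
proof -
  have "\<exists>\<Phi>. linear_functional \<Phi> \<and> (\<forall>i<Suc n. \<Phi> (delannoy_fps i) = y i)"
    by (rule fps_functional.vs1.ex_linear_functional_triangular
          [where \<Lambda> = "\<lambda>r f. fps_nth ((1 - fps_X) ^ r * f) r"])
       (simp_all add: linear_functional_fps_nth_mult fps_nth_one_minus_X_power_mult_delannoy_fps)
  thus ?thesis using that by (auto simp: less_Suc_eq_le)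
qed

section \<open>Left enriched partitions\<close>

definition words :: "nat \<Rightarrow> nat \<Rightarrow> (nat \<Rightarrow> nat) set" where
  "words n m = {1..n} \<rightarrow>\<^sub>E {..<m}"

lemma finite_words [simp]: "finite (words n m)"
  by (simp add: words_def finite_PiE)

lemma card_words: "card (words n m) = m ^ n"
  by (simp add: words_def card_PiE)

lemma words_comp_permutes:
  assumes "w \<in> words n m" "p permutes {1..n}"
  shows "w \<circ> p \<in> words n m"
  using assms(1) permutes_in_image[OF assms(2)] by (auto simp: words_def PiE_iff extensional_def)

text \<open>
  The letters \<open>0 < 1 < 2 < \<dots>\<close> encode \<open>0 < -1 < 1 < -2 < 2 < \<dots>\<close>, so the odd ones are negative.
\<close>

definition enriched_less :: "(nat \<Rightarrow> nat \<Rightarrow> bool) \<Rightarrow> (nat \<Rightarrow> nat) \<Rightarrow> nat \<Rightarrow> nat \<Rightarrow> bool" where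
  "enriched_less R a i j \<longleftrightarrow> a i < a j \<or> a i = a j \<and> (if even (a i) then R i j else R j i)"

lemma enriched_less_cong:
  assumes "a i = b i" "a j = b j" "R i j = S i j" "R j i = S j i"
  shows "enriched_less R a i j \<longleftrightarrow> enriched_less S b i j"
  using assms by (simp add: enriched_less_def)

lemma transp_enriched_less: "transp R \<Longrightarrow> transp (enriched_less R a)"
  by (rule transpI) (auto simp: enriched_less_def split: if_splits dest: transpD)

lemma irreflp_enriched_less: "irreflp R \<Longrightarrow> irreflp (enriched_less R a)"
  by (auto simp: irreflp_def enriched_less_def)

lemma totalp_enriched_less: "totalp R \<Longrightarrow> totalp (enriched_less R a)"
  by (auto simp: totalp_on_def enriched_less_def)

definition left_enriched :: "nat \<Rightarrow> (nat \<Rightarrow> nat) \<Rightarrow> nat \<Rightarrow> (nat \<Rightarrow> nat) set" where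
  "left_enriched n p m = {a \<in> words n m. \<forall>i\<in>{1..<n}. enriched_less (\<lambda>i j. p i < p j) a i (Suc i)}"

lemma finite_left_enriched [simp]: "finite (left_enriched n p m)"
  by (simp add: left_enriched_def)

lemma left_enriched_iff_pairs:
  "a \<in> left_enriched n p m \<longleftrightarrow>
     a \<in> words n m \<and> (\<forall>i\<in>{1..n}. \<forall>j\<in>{1..n}. i < j \<longrightarrow> enriched_less (\<lambda>i j. p i < p j) a i j)"
proof
  assume a: "a \<in> left_enriched n p m"
  have trans: "transp (enriched_less (\<lambda>i j. p i < p j) a)"
    by (intro transp_enriched_less transpI) simp
  have "enriched_less (\<lambda>i j. p i < p j) a i j" if "i < j" "1 \<le> i" "j \<le> n" for i j
    using that
  proof (induction i j rule: less_Suc_induct)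
    case (1 i)
    thus ?case using a by (simp add: left_enriched_def)
  next
    case (2 i j k)
    thus ?case using transpD[OF trans, of i j k] by simp
  qed
  thus "a \<in> words n m \<and> (\<forall>i\<in>{1..n}. \<forall>j\<in>{1..n}. i < j \<longrightarrow> enriched_less (\<lambda>i j. p i < p j) a i j)"
    using a by (simp add: left_enriched_def)
qed (auto simp: left_enriched_def)

lemma left_enriched_le:
  assumes "a \<in> left_enriched n p m" "1 \<le> i" "i \<le> j" "j \<le> n"
  shows "a i \<le> a j"
proof (cases "i = j")
  case False
  hence "enriched_less (\<lambda>i j. p i < p j) a i j"
    using assms by (simp add: left_enriched_iff_pairs)
  thus ?thesis by (auto simp: enriched_less_def)
qed simp

lemma left_enriched_0 [simp]: "left_enriched 0 p m = {\<lambda>_. undefined}"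
  by (auto simp: left_enriched_def words_def)

lemma left_enriched_no_letters [simp]: "n > 0 \<Longrightarrow> left_enriched n p 0 = {}"
  by (auto simp: left_enriched_def words_def PiE_iff)

text \<open>The last letter \<open>x\<close> may repeat the one before it only if its sign matches the step of \<open>p\<close>.\<close>

definition letter_bound :: "nat \<Rightarrow> (nat \<Rightarrow> nat) \<Rightarrow> nat \<Rightarrow> nat" where
  "letter_bound n p x =
     (if even x \<and> p n < p (Suc n) \<or> odd x \<and> p (Suc n) < p n then Suc x else x)"

lemma enriched_less_last_letter_iff:
  "enriched_less (\<lambda>i j. p i < p j) (a(Suc n := x)) n (Suc n) \<longleftrightarrow> a n < letter_bound n p x"
  by (auto simp: enriched_less_def letter_bound_def less_Suc_eq)

lemma fun_upd_mem_left_enriched_iff: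
  assumes "a (Suc n) = undefined"
  shows "a(Suc n := x) \<in> left_enriched (Suc n) p m \<longleftrightarrow>
    x < m \<and> a \<in> left_enriched n p (letter_bound n p x)"
proof -
  let ?a = "a(Suc n := x)" and ?less = "enriched_less (\<lambda>i j. p i < p j)"
  have prefix: "?less ?a i (Suc i) \<longleftrightarrow> ?less a i (Suc i)" if "i < n" for i
    using that by (simp add: enriched_less_def)
  show ?thesis
  proof
    assume a: "?a \<in> left_enriched (Suc n) p m"
    have "a i < letter_bound n p x" if "i \<in> {1..n}" for i
    proof -
      have "?a i \<le> ?a n" using that by (intro left_enriched_le[OF a]) auto
      moreover have "?less ?a n (Suc n)" using a that by (simp add: left_enriched_def)
      ultimately show ?thesis using enriched_less_last_letter_iff that by simp
    qed
    moreover have "a i = undefined" if "i \<notin> {1..n}" for i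
      using a assms that
      by (cases "i = Suc n")
         (auto simp: left_enriched_def words_def PiE_iff extensional_def split: if_splits)
    ultimately have "a \<in> words n (letter_bound n p x)"
      by (simp add: words_def PiE_iff extensional_def)
    moreover have "?less a i (Suc i)" if "i \<in> {1..<n}" for i
      using a prefix[of i] that by (simp add: left_enriched_def)
    moreover have "?a (Suc n) < m" using a unfolding left_enriched_def words_def by fastforce
    ultimately show "x < m \<and> a \<in> left_enriched n p (letter_bound n p x)"
      by (simp add: left_enriched_def)
  next
    assume a: "x < m \<and> a \<in> left_enriched n p (letter_bound n p x)"
    hence lt: "a i < letter_bound n p x" if "i \<in> {1..n}" for i
      using that by (auto simp: left_enriched_def words_def)
    have "letter_bound n p x \<le> m" using a by (simp add: letter_bound_def)
    hence "?a \<in> words (Suc n) m"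
      using a lt by (fastforce simp: left_enriched_def words_def PiE_iff extensional_def)
    moreover have "?less ?a i (Suc i)" if "i \<in> {1..<Suc n}" for i
      using a lt[of n] that prefix[of i] enriched_less_last_letter_iff
      by (cases "i = n") (auto simp: left_enriched_def)
    ultimately show "?a \<in> left_enriched (Suc n) p m" by (simp add: left_enriched_def)
  qed
qed

lemma card_left_enriched_Suc:
  "card (left_enriched (Suc n) p m) = (\<Sum>x<m. card (left_enriched n p (letter_bound n p x)))"
proof -
  let ?A = "SIGMA x:{..<m}. left_enriched n p (letter_bound n p x)"
  have undef: "a (Suc n) = undefined" if "a \<in> left_enriched n p k" for a k
    using that by (auto simp: left_enriched_def words_def PiE_iff extensional_def)
  have "bij_betw (\<lambda>(x, a). a(Suc n := x)) ?A (left_enriched (Suc n) p m)"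
  proof (rule bij_betwI[where g = "\<lambda>a. (a (Suc n), a(Suc n := undefined))"])
    show "(\<lambda>(x, a). a(Suc n := x)) \<in> ?A \<rightarrow> left_enriched (Suc n) p m"
      using undef by (auto simp: fun_upd_mem_left_enriched_iff)
    show "(\<lambda>a. (a (Suc n), a(Suc n := undefined))) \<in> left_enriched (Suc n) p m \<rightarrow> ?A"
    proof
      fix a assume "a \<in> left_enriched (Suc n) p m"
      thus "(a (Suc n), a(Suc n := undefined)) \<in> ?A"
        using fun_upd_mem_left_enriched_iff[of "a(Suc n := undefined)" n "a (Suc n)" p m] by simp
    qed
  qed (auto simp: fun_eq_iff intro: undef[symmetric])
  from bij_betw_same_card[OF this] show ?thesis by simp
qed

section \<open>The generating function of left enriched partitions\<close>

definition enriched_fps_odd :: "nat \<Rightarrow> (nat \<Rightarrow> nat) \<Rightarrow> 'a::comm_ring_1 fps" where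
  "enriched_fps_odd n p = Abs_fps (\<lambda>k. of_nat (card (left_enriched n p (2 * k + 1))))"

definition enriched_fps_even :: "nat \<Rightarrow> (nat \<Rightarrow> nat) \<Rightarrow> 'a::comm_ring_1 fps" where
  "enriched_fps_even n p = Abs_fps (\<lambda>k. of_nat (card (left_enriched n p (2 * k))))"

lemma enriched_fps_odd_0: "(1 - fps_X) * enriched_fps_odd 0 p = (1 :: 'a::comm_ring_1 fps)"
  by (rule one_minus_fps_X_mult_eqI) (simp_all add: enriched_fps_odd_def)

lemma enriched_fps_odd_Suc_ascent:
  assumes "n = 0 \<or> p n < p (Suc n)"
  shows "(1 - fps_X) * enriched_fps_odd (Suc n) p =
    (1 + fps_X) * (enriched_fps_odd n p :: 'a::comm_ring_1 fps)"
  by (rule one_minus_fps_X_mult_eqI)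
     (use assms in \<open>auto simp: enriched_fps_odd_def card_left_enriched_Suc letter_bound_def
        algebra_simps\<close>)

lemma enriched_fps_even_Suc_ascent:
  assumes "n = 0 \<or> p n < p (Suc n)"
  shows "(1 - fps_X) * enriched_fps_even (Suc n) p =
    2 * fps_X * (enriched_fps_odd n p :: 'a::comm_ring_1 fps)"
  by (rule one_minus_fps_X_mult_eqI)
     (use assms in \<open>auto simp: enriched_fps_odd_def enriched_fps_even_def card_left_enriched_Suc
        letter_bound_def algebra_simps numeral_fps_const\<close>)

lemma enriched_fps_odd_Suc_descent:
  assumes "n > 0" "p (Suc n) < p n"
  shows "(1 - fps_X) * enriched_fps_odd (Suc n) p =
    2 * (enriched_fps_even n p :: 'a::comm_ring_1 fps)"
  by (rule one_minus_fps_X_mult_eqI)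
     (use assms in \<open>auto simp: enriched_fps_odd_def enriched_fps_even_def card_left_enriched_Suc
        letter_bound_def algebra_simps numeral_fps_const\<close>)

lemma enriched_fps_even_Suc_descent:
  assumes "n > 0" "p (Suc n) < p n"
  shows "(1 - fps_X) * enriched_fps_even (Suc n) p =
    (1 + fps_X) * (enriched_fps_even n p :: 'a::comm_ring_1 fps)"
  by (rule one_minus_fps_X_mult_eqI)
     (use assms in \<open>auto simp: enriched_fps_even_def card_left_enriched_Suc letter_bound_def
        algebra_simps\<close>)

lemma left_peaks_eq:
  "left_peaks n p = {i \<in> {1..<n}. p (Suc i) < p i \<and> (i = 1 \<or> p (i - 1) < p i)}"
proof (rule set_eqI)
  fix i
  show "i \<in> left_peaks n p \<longleftrightarrow> i \<in> {i \<in> {1..<n}. p (Suc i) < p i \<and> (i = 1 \<or> p (i - 1) < p i)}"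
    by (cases "i = 1") (auto simp: left_peaks_def is_peak_def numeral_2_eq_2)
qed

lemma lpk_Suc: "lpk (Suc n) p = lpk n p + (if n \<in> left_peaks (Suc n) p then 1 else 0)"
proof (cases "n \<in> left_peaks (Suc n) p")
  case True
  hence "left_peaks (Suc n) p = insert n (left_peaks n p)" "n \<notin> left_peaks n p"
    by (auto simp: left_peaks_eq less_Suc_eq)
  moreover have "finite (left_peaks n p)" by (simp add: left_peaks_eq)
  ultimately show ?thesis by (simp add: lpk_def)
next
  case False
  hence "left_peaks (Suc n) p = left_peaks n p"
    by (auto simp: left_peaks_eq less_Suc_eq)
  thus ?thesis using False by (simp add: lpk_def)
qed

lemma two_lpk_le: "2 * lpk n p \<le> n"
proof -
  let ?L = "left_peaks n p"
  have "?L \<union> Suc ` ?L \<subseteq> {1..n}" "?L \<inter> Suc ` ?L = {}"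
    by (auto simp: left_peaks_eq)
  moreover have "finite ?L" by (simp add: left_peaks_eq)
  ultimately have "card ?L + card (Suc ` ?L) \<le> card {1..n}"
    by (metis card_Un_disjoint card_mono finite_atLeastAtMost finite_imageI)
  thus ?thesis by (simp add: lpk_def card_image)
qed

lemma enriched_fps_odd_Suc_left_peak:
  assumes "n \<in> left_peaks (Suc n) p"
  shows "(1 - fps_X) * (1 + fps_X) * enriched_fps_odd (Suc n) p =
    4 * fps_X * (enriched_fps_odd n p :: 'a::idom fps)"
proof -
  obtain m where n: "n = Suc m" and p: "p (Suc n) < p n" "m = 0 \<or> p m < p (Suc m)"
    using assms by (cases n) (auto simp: left_peaks_eq)
  have "(1 - fps_X) * enriched_fps_odd n p = (1 + fps_X) * (enriched_fps_odd m p :: 'a fps)"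
    and "(1 - fps_X) * enriched_fps_even n p = 2 * fps_X * (enriched_fps_odd m p :: 'a fps)"
    and "(1 - fps_X) * enriched_fps_odd (Suc n) p = 2 * (enriched_fps_even n p :: 'a fps)"
    using n p
    by (simp_all add: enriched_fps_odd_Suc_ascent enriched_fps_even_Suc_ascent
        enriched_fps_odd_Suc_descent)
  hence "(1 - fps_X) * ((1 - fps_X) * (1 + fps_X) * enriched_fps_odd (Suc n) p)
       = (1 - fps_X) * (4 * fps_X * (enriched_fps_odd n p :: 'a fps))"
    by algebra
  thus ?thesis by (simp add: one_minus_fps_X_neq_0)
qed

lemma enriched_fps_odd_Suc_no_left_peak:
  assumes "inj p" "n \<notin> left_peaks (Suc n) p"
  shows "(1 - fps_X) * enriched_fps_odd (Suc n) p =
    (1 + fps_X) * (enriched_fps_odd n p :: 'a::idom fps)"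
proof (cases "n = 0 \<or> p n < p (Suc n)")
  case True
  thus ?thesis by (rule enriched_fps_odd_Suc_ascent)
next
  case False
  have distinct: "p (Suc i) \<noteq> p i" for i
    using injD[OF assms(1), of "Suc i" i] by auto
  have n: "n > 0" "p (Suc n) < p n"
    using False distinct[of n] by linarith+
  hence "n \<noteq> 1" "\<not> p (n - 1) < p n"
    using assms(2) by (auto simp: left_peaks_eq)
  moreover obtain m where m: "n = Suc m"
    using n(1) gr0_conv_Suc by blast
  ultimately have "m > 0" "p n < p m"
    using distinct[of m] by auto
  hence "(1 - fps_X) * enriched_fps_odd n p = 2 * (enriched_fps_even m p :: 'a fps)"
    and "(1 - fps_X) * enriched_fps_even n p = (1 + fps_X) * (enriched_fps_even m p :: 'a fps)"
    and "(1 - fps_X) * enriched_fps_odd (Suc n) p = 2 * (enriched_fps_even n p :: 'a fps)"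
    using n m by (simp_all add: enriched_fps_odd_Suc_descent enriched_fps_even_Suc_descent)
  hence "(1 - fps_X) * ((1 - fps_X) * enriched_fps_odd (Suc n) p)
       = (1 - fps_X) * ((1 + fps_X) * (enriched_fps_odd n p :: 'a fps))"
    by algebra
  thus ?thesis by (simp add: one_minus_fps_X_neq_0)
qed

lemma enriched_fps_odd_mult_powers:
  assumes "inj p"
  shows "enriched_fps_odd n p * (1 - fps_X) ^ Suc n * (1 + fps_X) ^ (2 * lpk n p)
    = (1 + fps_X) ^ n * (4 * fps_X :: 'a::idom fps) ^ lpk n p"
proof (induction n)
  case 0
  show ?case
    using enriched_fps_odd_0[of p, where 'a = 'a] by (simp add: lpk_def left_peaks_eq mult.commute)
next
  case (Suc n)
  define A C E F :: "'a fps"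
    where "A = 1 - fps_X" and "C = 1 + fps_X"
      and "E = enriched_fps_odd n p" and "F = enriched_fps_odd (Suc n) p"
  define l where "l = lpk n p"
  have IH: "E * A ^ Suc n * C ^ (2 * l) = C ^ n * (4 * fps_X) ^ l"
    using Suc by (simp only: A_def C_def E_def l_def)
  have "F * A ^ Suc (Suc n) * C ^ (2 * lpk (Suc n) p) = C ^ Suc n * (4 * fps_X) ^ lpk (Suc n) p"
  proof (cases "n \<in> left_peaks (Suc n) p")
    case True
    have "F * A ^ Suc (Suc n) * C ^ (2 * Suc l) = C * (A * C * F) * A ^ Suc n * C ^ (2 * l)"
      by (simp add: mult_ac)
    also have "A * C * F = 4 * fps_X * E"
      unfolding A_def C_def E_def F_def using True by (rule enriched_fps_odd_Suc_left_peak)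
    also have "C * (4 * fps_X * E) * A ^ Suc n * C ^ (2 * l) =
        4 * fps_X * C * (E * A ^ Suc n * C ^ (2 * l))"
      by (simp only: mult_ac)
    also have "\<dots> = C ^ Suc n * (4 * fps_X) ^ Suc l"
      unfolding IH by (simp add: mult_ac)
    also have "Suc l = lpk (Suc n) p" using True by (simp add: lpk_Suc l_def)
    finally show ?thesis .
  next
    case False
    have "F * A ^ Suc (Suc n) * C ^ (2 * l) = (A * F) * A ^ Suc n * C ^ (2 * l)"
      by (simp add: mult_ac)
    also have "A * F = C * E"
      unfolding A_def C_def E_def F_def
      using assms False by (rule enriched_fps_odd_Suc_no_left_peak)
    also have "C * E * A ^ Suc n * C ^ (2 * l) = C * (E * A ^ Suc n * C ^ (2 * l))"
      by (simp only: mult_ac)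
    also have "\<dots> = C ^ Suc n * (4 * fps_X) ^ l"
      unfolding IH by (simp add: mult_ac)
    also have "l = lpk (Suc n) p" using False by (simp add: lpk_Suc l_def)
    finally show ?thesis .
  qed
  thus ?case by (simp only: A_def C_def F_def)
qed

lemma enriched_fps_odd_closed_form:
  assumes "inj p"
  shows "enriched_fps_odd n p * (1 - fps_X) ^ Suc n =
    (1 + fps_X) ^ (n - 2 * lpk n p) * ((1 + fps_X) ^ 2 - (1 - fps_X :: 'a::idom fps) ^ 2) ^ lpk n p"
proof -
  have four_X: "4 * fps_X = (1 + fps_X) ^ 2 - (1 - fps_X :: 'a fps) ^ 2"
    by (simp add: power2_eq_square algebra_simps)
  have "(1 + fps_X :: 'a fps) ^ n = (1 + fps_X) ^ (n - 2 * lpk n p) * (1 + fps_X) ^ (2 * lpk n p)"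
    using two_lpk_le by (simp flip: power_add)
  hence "enriched_fps_odd n p * (1 - fps_X) ^ Suc n * (1 + fps_X) ^ (2 * lpk n p) =
      (1 + fps_X) ^ (n - 2 * lpk n p) * ((1 + fps_X) ^ 2 - (1 - fps_X :: 'a fps) ^ 2) ^ lpk n p
        * (1 + fps_X) ^ (2 * lpk n p)"
    using enriched_fps_odd_mult_powers[OF assms, of n, where 'a = 'a]
    unfolding four_X by (simp only: mult_ac)
  thus ?thesis using one_plus_fps_X_neq_0 by (metis mult_right_cancel power_not_zero)
qed

lemma lpk_id: "lpk n id = 0"
  by (simp add: lpk_def left_peaks_eq)

lemma enriched_fps_odd_id: "enriched_fps_odd n id = (delannoy_fps n :: 'a::idom fps)"
proof -
  have "enriched_fps_odd n id * (1 - fps_X) ^ Suc n =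
      delannoy_fps n * (1 - fps_X :: 'a fps) ^ Suc n"
    by (simp add: enriched_fps_odd_closed_form lpk_id delannoy_fps_mult_power del: power_Suc)
  thus ?thesis by (simp add: one_minus_fps_X_neq_0)
qed

lemma power_mult_power_diff_squares_eq_sum:
  fixes a c :: "'a::comm_ring_1"
  assumes "2 * k \<le> n"
  shows "c ^ (n - 2 * k) * (c ^ 2 - a ^ 2) ^ k =
    (\<Sum>l\<le>k. (-1) ^ l * of_nat (k choose l) * (c ^ (n - 2 * l) * a ^ (2 * l)))"
proof -
  have "c ^ (n - 2 * k) * (c ^ 2 - a ^ 2) ^ k = c ^ (n - 2 * k) * (- (a ^ 2) + c ^ 2) ^ k"
    by simp
  also have "\<dots> =
      (\<Sum>l\<le>k. of_nat (k choose l) * (- (a ^ 2)) ^ l * ((c ^ 2) ^ (k - l) * c ^ (n - 2 * k)))"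
    by (simp only: binomial_ring sum_distrib_left mult_ac)
  also have "\<dots> = (\<Sum>l\<le>k. (-1) ^ l * of_nat (k choose l) * (c ^ (n - 2 * l) * a ^ (2 * l)))"
  proof (rule sum.cong[OF refl])
    fix l assume "l \<in> {..k}"
    hence "n - 2 * l = 2 * (k - l) + (n - 2 * k)" using assms by simp
    hence "(c ^ 2) ^ (k - l) * c ^ (n - 2 * k) = c ^ (n - 2 * l)"
      by (simp flip: power_mult power_add)
    moreover have "(- (a ^ 2)) ^ l = (-1) ^ l * a ^ (2 * l)"
      by (simp add: power_minus[of "a ^ 2"] power_mult)
    ultimately show "of_nat (k choose l) * (- (a ^ 2)) ^ l * ((c ^ 2) ^ (k - l) * c ^ (n - 2 * k)) =
        (-1) ^ l * of_nat (k choose l) * (c ^ (n - 2 * l) * a ^ (2 * l))"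
      by (simp only: mult_ac)
  qed
  finally show ?thesis .
qed

lemma enriched_fps_odd_eq_sum_delannoy_fps:
  assumes "inj p"
  shows "enriched_fps_odd n p = (\<Sum>l\<le>lpk n p.
    fps_const ((-1) ^ l * of_nat (lpk n p choose l)) * (delannoy_fps (n - 2 * l) :: 'a::idom fps))"
    (is "_ = ?S")
proof -
  define A where "A = (1 - fps_X :: 'a fps)"
  have "enriched_fps_odd n p * A ^ Suc n = (\<Sum>l\<le>lpk n p.
      (-1) ^ l * of_nat (lpk n p choose l) * ((1 + fps_X) ^ (n - 2 * l) * A ^ (2 * l)))"
    unfolding A_def enriched_fps_odd_closed_form[OF assms]
    by (rule power_mult_power_diff_squares_eq_sum) (rule two_lpk_le)
  also have "\<dots> = ?S * A ^ Suc n"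
    unfolding sum_distrib_right
  proof (rule sum.cong[OF refl])
    fix l assume "l \<in> {..lpk n p}"
    hence "2 * l \<le> n" using two_lpk_le[of n p] by simp
    hence "delannoy_fps (n - 2 * l) * A ^ Suc n = (1 + fps_X) ^ (n - 2 * l) * A ^ (2 * l)"
      unfolding A_def by (rule delannoy_fps_diff_mult_power)
    moreover have "fps_const ((-1) ^ l * of_nat (lpk n p choose l)) =
        ((-1) ^ l * of_nat (lpk n p choose l) :: 'a fps)"
      by (simp add: fps_of_nat flip: fps_const_mult fps_const_power fps_const_neg)
    ultimately show "(-1) ^ l * of_nat (lpk n p choose l) * ((1 + fps_X) ^ (n - 2 * l) * A ^ (2 * l)) =
        fps_const ((-1) ^ l * of_nat (lpk n p choose l)) * delannoy_fps (n - 2 * l) * A ^ Suc n"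
      by (simp only: mult.assoc)
  qed
  finally show ?thesis by (simp add: A_def one_minus_fps_X_neq_0)
qed

section \<open>Standardization\<close>

definition rank_perm :: "nat \<Rightarrow> (nat \<Rightarrow> nat \<Rightarrow> bool) \<Rightarrow> nat \<Rightarrow> nat" where
  "rank_perm n R i = (if i \<in> {1..n} then Suc (card {j \<in> {1..n}. R j i}) else i)"

lemma rank_perm_less_iff:
  assumes R: "transp R" "irreflp R" "totalp R" and "i \<in> {1..n}" "j \<in> {1..n}"
  shows "rank_perm n R i < rank_perm n R j \<longleftrightarrow> R i j"
proof -
  have mono: "rank_perm n R k < rank_perm n R l" if "k \<in> {1..n}" "l \<in> {1..n}" "R k l" for k l
  proof -
    have "{j \<in> {1..n}. R j k} \<subseteq> {j \<in> {1..n}. R j l}"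
      using transpD[OF R(1) _ that(3)] by blast
    moreover have "k \<in> {j \<in> {1..n}. R j l} - {j \<in> {1..n}. R j k}"
      using that irreflpD[OF R(2)] by blast
    ultimately have "{j \<in> {1..n}. R j k} \<subset> {j \<in> {1..n}. R j l}" by blast
    thus ?thesis using that by (simp add: rank_perm_def psubset_card_mono)
  qed
  show ?thesis
  proof
    assume "rank_perm n R i < rank_perm n R j"
    hence "i \<noteq> j" "\<not> R j i" using mono[OF assms(5,4)] by auto
    thus "R i j" using totalpD[OF R(3), of i j] by blast
  qed (rule mono[OF assms(4,5)])
qed

lemma rank_perm_permutes:
  assumes R: "transp R" "irreflp R" "totalp R"
  shows "rank_perm n R permutes {1..n}"
proof (rule bij_imp_permutes)
  have inj: "inj_on (rank_perm n R) {1..n}"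
  proof (rule inj_onI)
    fix i j assume "i \<in> {1..n}" "j \<in> {1..n}" "rank_perm n R i = rank_perm n R j"
    hence "\<not> R i j" "\<not> R j i" by (metis less_irrefl rank_perm_less_iff[OF R])+
    thus "i = j" using totalpD[OF R(3), of i j] by blast
  qed
  have "rank_perm n R i \<in> {1..n}" if "i \<in> {1..n}" for i
  proof -
    have "{j \<in> {1..n}. R j i} \<subset> {1..n}" using that irreflpD[OF R(2)] by blast
    hence "card {j \<in> {1..n}. R j i} < card {1..n}" by (rule psubset_card_mono[rotated]) simp
    thus ?thesis using that by (simp add: rank_perm_def)
  qed
  hence "rank_perm n R ` {1..n} = {1..n}" using inj by (intro endo_inj_surj) auto
  thus "bij_betw (rank_perm n R) {1..n} {1..n}" using inj by (simp add: bij_betw_def)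
qed (auto simp: rank_perm_def)

lemma rank_perm_eqI:
  assumes p: "p permutes {1..n}"
    and R: "\<And>i j. i \<in> {1..n} \<Longrightarrow> j \<in> {1..n} \<Longrightarrow> R i j \<longleftrightarrow> p i < p j"
  shows "rank_perm n R = p"
proof
  fix i
  show "rank_perm n R i = p i"
  proof (cases "i \<in> {1..n}")
    case True
    have "p i \<in> {1..n}" using True permutes_in_image[OF p] by blast
    moreover have "p ` {j \<in> {1..n}. R j i} = {y \<in> p ` {1..n}. y < p i}"
      using R True by auto
    ultimately have "p ` {j \<in> {1..n}. R j i} = {1..<p i}"
      using permutes_image[OF p] by auto
    hence "card {j \<in> {1..n}. R j i} = card {1..<p i}"
      by (metis card_image inj_on_subset permutes_inj[OF p] subset_UNIV)
    thus ?thesis using True \<open>p i \<in> {1..n}\<close> by (simp add: rank_perm_def)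
  next
    case False
    thus ?thesis using permutes_not_in[OF p False] by (auto simp: rank_perm_def)
  qed
qed

definition standardization :: "nat \<Rightarrow> (nat \<Rightarrow> nat) \<Rightarrow> nat \<Rightarrow> nat" where
  "standardization n w = rank_perm n (enriched_less (<) w)"

lemma standardization_less_iff:
  assumes "i \<in> {1..n}" "j \<in> {1..n}"
  shows "standardization n w i < standardization n w j \<longleftrightarrow> enriched_less (<) w i j"
  unfolding standardization_def using assms
  by (intro rank_perm_less_iff transp_enriched_less irreflp_enriched_less totalp_enriched_less) auto

lemma standardization_permutes: "standardization n w permutes {1..n}"
  unfolding standardization_def
  by (intro rank_perm_permutes transp_enriched_less irreflp_enriched_less totalp_enriched_less) auto

lemma standardization_eq_iff:
  assumes "p permutes {1..n}"
  shows "standardization n w = p \<longleftrightarrow>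
    (\<forall>i\<in>{1..n}. \<forall>j\<in>{1..n}. p i < p j \<longrightarrow> enriched_less (<) w i j)"
proof
  assume mono: "\<forall>i\<in>{1..n}. \<forall>j\<in>{1..n}. p i < p j \<longrightarrow> enriched_less (<) w i j"
  have asym: "\<not> enriched_less (<) w j i" if "enriched_less (<) w i j" for i j
    using that by (cases "w i" "w j" rule: linorder_cases) (auto simp: enriched_less_def)
  have "enriched_less (<) w i j \<longleftrightarrow> p i < p j" if "i \<in> {1..n}" "j \<in> {1..n}" for i j
  proof (cases "p i" "p j" rule: linorder_cases)
    case less
    thus ?thesis using mono that by blast
  next
    case equal
    hence "i = j" using permutes_inj[OF assms] by (simp add: inj_eq)
    thus ?thesis by (simp add: enriched_less_def)
  next
    case greater
    hence "enriched_less (<) w j i" using mono that by blast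
    thus ?thesis using asym[of j i] greater by simp
  qed
  thus "standardization n w = p"
    unfolding standardization_def by (intro rank_perm_eqI assms)
next
  assume eq: "standardization n w = p"
  show "\<forall>i\<in>{1..n}. \<forall>j\<in>{1..n}. p i < p j \<longrightarrow> enriched_less (<) w i j"
    using standardization_less_iff[of _ n _ w] by (simp add: eq)
qed

lemma comp_inv_mem_left_enriched_iff:
  assumes p: "p permutes {1..n}" and w: "w \<in> words n m"
  shows "w \<circ> inv p \<in> left_enriched n (inv p) m \<longleftrightarrow> standardization n w = p"
proof -
  have "w \<circ> inv p \<in> words n m"
    using w permutes_inv[OF p] by (rule words_comp_permutes)
  hence "w \<circ> inv p \<in> left_enriched n (inv p) m \<longleftrightarrow>
      (\<forall>i\<in>{1..n}. \<forall>j\<in>{1..n}. i < j \<longrightarrow> enriched_less (<) w (inv p i) (inv p j))"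
    by (simp add: left_enriched_iff_pairs enriched_less_def)
  also have "\<dots> \<longleftrightarrow> (\<forall>i\<in>p ` {1..n}. \<forall>j\<in>p ` {1..n}. i < j \<longrightarrow> enriched_less (<) w (inv p i) (inv p j))"
    by (simp only: permutes_image[OF p])
  also have "\<dots> \<longleftrightarrow> standardization n w = p"
    by (simp add: standardization_eq_iff[OF p] permutes_inverses[OF p])
  finally show ?thesis .
qed

lemma card_standardization_eq:
  assumes "p permutes {1..n}"
  shows "card {w \<in> words n m. standardization n w = p} = card (left_enriched n (inv p) m)"
proof -
  have "bij_betw (\<lambda>w. w \<circ> inv p) (words n m) (words n m)"
    by (rule bij_betwI[where g = "\<lambda>w. w \<circ> p"])
       (auto simp: words_comp_permutes assms permutes_inv permutes_inverses[OF assms] fun_eq_iff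
          simp del: One_nat_def)
  hence "bij_betw (\<lambda>w. w \<circ> inv p) {w \<in> words n m. standardization n w = p}
      {a \<in> words n m. a \<in> left_enriched n (inv p) m}"
    by (rule bij_betw_Collect) (simp add: comp_inv_mem_left_enriched_iff[OF assms])
  moreover have "{a \<in> words n m. a \<in> left_enriched n (inv p) m} = left_enriched n (inv p) m"
    by (auto simp: left_enriched_def)
  ultimately show ?thesis by (simp add: bij_betw_same_card)
qed

lemma sum_permutes_standardization:
  fixes f :: "(nat \<Rightarrow> nat) \<Rightarrow> nat"
  shows "(\<Sum>p | p permutes {1..n}. f p * card (left_enriched n (inv p) m)) =
    (\<Sum>w\<in>words n m. f (standardization n w))"
proof -
  have "(\<Sum>p | p permutes {1..n}. f p * card (left_enriched n (inv p) m)) =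
      (\<Sum>p | p permutes {1..n}.
        \<Sum>w | w \<in> words n m \<and> standardization n w = p. f (standardization n w))"
    by (intro sum.cong refl) (simp add: mult.commute flip: card_standardization_eq)
  also have "\<dots> = (\<Sum>w\<in>words n m. f (standardization n w))"
    using standardization_permutes
    by (intro sum.group) (auto simp: finite_permutations simp del: One_nat_def)
  finally show ?thesis .
qed

lemma sum_card_left_enriched: "(\<Sum>p | p permutes {1..n}. card (left_enriched n p m)) = m ^ n"
  using sum_permutes_standardization[of "\<lambda>_. 1" n m]
    sum_permutations_inverse[where f = "\<lambda>p. card (left_enriched n p m)" and S = "{1..n}"]
  by (simp add: card_words)

text \<open>
  The boustrophedon enumeration of a rectangle: reversing every other row mirrors the rule that ties
  between odd letters are broken backwards.
\<close>

definition snake :: "nat \<Rightarrow> nat \<Rightarrow> nat \<Rightarrow> nat" where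
  "snake m x y = x * m + (if even x then y else m - 1 - y)"

lemma snake_less_mult:
  assumes "x < l" "y < m"
  shows "snake m x y < l * m"
proof -
  have "snake m x y < Suc x * m" using assms by (auto simp: snake_def)
  also have "\<dots> \<le> l * m" using assms by (intro mult_right_mono) auto
  finally show ?thesis .
qed

lemma snake_less_iff:
  assumes "y < m" "y' < m"
  shows "snake m x y < snake m x' y' \<longleftrightarrow> x < x' \<or> x = x' \<and> (if even x then y < y' else y' < y)"
proof -
  have lt: "snake m x y < snake m x' y'" if "x < x'" "y < m" for x x' y y'
    using snake_less_mult[OF that] by (simp add: snake_def)
  show ?thesis
    using lt[of x x' y y'] lt[of x' x y' y] assms
    by (cases x x' rule: linorder_cases) (auto simp: snake_def)
qed

lemma snake_eq_iff:
  assumes "y < m" "y' < m"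
  shows "snake m x y = snake m x' y' \<longleftrightarrow> x = x' \<and> y = y'"
  using snake_less_iff[OF assms, of x x'] snake_less_iff[OF assms(2,1), of x' x]
  by (cases x x' rule: linorder_cases; cases y y' rule: linorder_cases) (auto split: if_splits)

lemma even_snake_iff:
  assumes "odd m" "y < m"
  shows "even (snake m x y) \<longleftrightarrow> even (x + y)"
  using assms by (auto simp: snake_def)

lemma enriched_less_snake:
  assumes "odd m" "w i < m" "w j < m"
  shows "enriched_less R (\<lambda>i. snake m (a i) (w i)) i j \<longleftrightarrow> enriched_less (enriched_less R w) a i j"
  unfolding enriched_less_def snake_less_iff[OF assms(2,3)] snake_eq_iff[OF assms(2,3)]
    even_snake_iff[OF assms(1,2)]
  by auto

definition snake_word :: "nat \<Rightarrow> nat \<Rightarrow> (nat \<Rightarrow> nat) \<times> (nat \<Rightarrow> nat) \<Rightarrow> nat \<Rightarrow> nat" where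
  "snake_word n m = (\<lambda>(w, a). \<lambda>i\<in>{1..n}. snake m (a i) (w i))"

lemma snake_word_bij:
  "bij_betw (snake_word n m) (words n m \<times> words n l) (words n (l * m))"
proof (rule bij_betw_imageI)
  show inj: "inj_on (snake_word n m) (words n m \<times> words n l)"
  proof (rule inj_onI, clarify, rule conjI)
    fix w a w' a'
    assume words: "w \<in> words n m" "a \<in> words n l" "w' \<in> words n m" "a' \<in> words n l"
      and eq: "snake_word n m (w, a) = snake_word n m (w', a')"
    have pointwise: "a i = a' i \<and> w i = w' i" if "i \<in> {1..n}" for i
    proof -
      have "w i < m" "w' i < m" using words that by (auto simp: words_def)
      moreover have "snake m (a i) (w i) = snake m (a' i) (w' i)"
        using fun_cong[OF eq, of i] that by (simp add: snake_word_def)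
      ultimately show ?thesis by (simp add: snake_eq_iff)
    qed
    show "w = w'"
      using words(1,3) pointwise unfolding words_def by (intro PiE_ext[of w _ _ w']) auto
    show "a = a'"
      using words(2,4) pointwise unfolding words_def by (intro PiE_ext[of a _ _ a']) auto
  qed
  have "snake_word n m ` (words n m \<times> words n l) \<subseteq> words n (l * m)"
    by (auto simp: snake_word_def words_def PiE_iff intro!: snake_less_mult)
  moreover have "card (snake_word n m ` (words n m \<times> words n l)) = card (words n (l * m))"
    by (simp add: card_image[OF inj] card_cartesian_product card_words power_mult_distrib)
  ultimately show "snake_word n m ` (words n m \<times> words n l) = words n (l * m)"
    by (simp add: card_subset_eq)
qed

lemma snake_word_mem_left_enriched_iff:
  assumes "odd m" "w \<in> words n m" "a \<in> words n l"
  shows "snake_word n m (w, a) \<in> left_enriched n id (l * m) \<longleftrightarrow>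
    a \<in> left_enriched n (standardization n w) l"
proof -
  have "enriched_less (\<lambda>i j. id i < id j) (snake_word n m (w, a)) i j \<longleftrightarrow>
      enriched_less (\<lambda>i j. standardization n w i < standardization n w j) a i j"
    if ij: "i \<in> {1..n}" "j \<in> {1..n}" for i j
  proof -
    have "enriched_less (\<lambda>i j. id i < id j) (snake_word n m (w, a)) i j \<longleftrightarrow>
        enriched_less (<) (\<lambda>i. snake m (a i) (w i)) i j"
      using ij by (intro enriched_less_cong) (simp_all add: snake_word_def)
    also have "\<dots> \<longleftrightarrow> enriched_less (enriched_less (<) w) a i j"
      using assms(1,2) ij by (intro enriched_less_snake) (auto simp: words_def)
    also have "\<dots> \<longleftrightarrow> enriched_less (\<lambda>i j. standardization n w i < standardization n w j) a i j"
      using ij by (intro enriched_less_cong) (simp_all add: standardization_less_iff)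
    finally show ?thesis .
  qed
  moreover have "snake_word n m (w, a) \<in> words n (l * m)"
    using bij_betw_apply[OF snake_word_bij] assms(2,3) by blast
  ultimately show ?thesis using assms(3) by (simp add: left_enriched_iff_pairs)
qed

lemma sum_card_left_enriched_mult_inv:
  assumes "odd m"
  shows "(\<Sum>p | p permutes {1..n}. card (left_enriched n p l) * card (left_enriched n (inv p) m)) =
    card (left_enriched n id (l * m))"
proof -
  let ?Z = "SIGMA w:words n m. left_enriched n (standardization n w) l"
  let ?Z' = "{z \<in> words n m \<times> words n l. snd z \<in> left_enriched n (standardization n (fst z)) l}"
  have "bij_betw (snake_word n m) ?Z'
      {z \<in> words n (l * m). z \<in> left_enriched n id (l * m)}"
    by (rule bij_betw_Collect[OF snake_word_bij])
       (auto simp: snake_word_mem_left_enriched_iff[OF assms])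
  moreover have "?Z' = ?Z"
    "{z \<in> words n (l * m). z \<in> left_enriched n id (l * m)} = left_enriched n id (l * m)"
    by (auto simp: left_enriched_def)
  ultimately have "card ?Z = card (left_enriched n id (l * m))" by (simp add: bij_betw_same_card)
  thus ?thesis by (simp add: sum_permutes_standardization del: One_nat_def)
qed

section \<open>Extracting the peak polynomials\<close>

definition odd_power_fps :: "nat \<Rightarrow> 'a::comm_ring_1 fps" where
  "odd_power_fps m = Abs_fps (\<lambda>k. of_nat (2 * k + 1) ^ m)"

lemma odd_power_fps_eq_sum: "odd_power_fps m = (\<Sum>p | p permutes {1..m}. enriched_fps_odd m p)"
  by (rule fps_ext)
     (simp add: odd_power_fps_def fps_sum_nth enriched_fps_odd_def del: of_nat_Suc
        flip: of_nat_sum sum_card_left_enriched of_nat_power)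

locale left_peak_functional =
  fixes \<Phi> :: "'a::field_char_0 fps \<Rightarrow> 'a" and n :: nat and s :: 'a
  assumes linear: "linear_functional \<Phi>"
    and delannoy_fps: "i \<le> n \<Longrightarrow> \<Phi> (delannoy_fps i) = (1 - s) ^ ((n - i) div 2)"
begin

lemma enriched_fps_odd:
  assumes "m \<le> n" "even (n - m)" "inj p"
  shows "\<Phi> (enriched_fps_odd m p) = (1 - s) ^ ((n - m) div 2) * s ^ lpk m p"
proof -
  define L where "L = lpk m p"
  have "\<Phi> (enriched_fps_odd m p) =
      (\<Sum>l\<le>L. (-1) ^ l * of_nat (L choose l) * \<Phi> (delannoy_fps (m - 2 * l)))"
    unfolding L_def
    by (simp only: enriched_fps_odd_eq_sum_delannoy_fps[OF assms(3)]
        linear_functional_sum_scale[OF linear])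
  also have "\<dots> =
      (\<Sum>l\<le>L. (1 - s) ^ ((n - m) div 2) * (of_nat (L choose l) * (- (1 - s)) ^ l * 1 ^ (L - l)))"
  proof (rule sum.cong[OF refl])
    fix l assume "l \<in> {..L}"
    hence "(n - (m - 2 * l)) div 2 = (n - m) div 2 + l"
      using two_lpk_le[of m p] assms(1,2) by (auto simp: L_def elim!: evenE)
    hence "\<Phi> (delannoy_fps (m - 2 * l)) = (1 - s) ^ ((n - m) div 2) * (1 - s) ^ l"
      using assms(1) by (simp add: delannoy_fps power_add)
    thus "(-1) ^ l * of_nat (L choose l) * \<Phi> (delannoy_fps (m - 2 * l)) =
        (1 - s) ^ ((n - m) div 2) * (of_nat (L choose l) * (- (1 - s)) ^ l * 1 ^ (L - l))"
      by (simp only: power_minus[of "1 - s"] power_one mult_1_left mult_1_right mult_ac)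
  qed
  also have "\<dots> = (1 - s) ^ ((n - m) div 2) * (- (1 - s) + 1) ^ L"
    by (simp only: binomial_ring sum_distrib_left)
  finally show ?thesis by (simp add: L_def)
qed

lemma odd_power_fps:
  assumes "m \<le> n" "even (n - m)"
  shows "\<Phi> (odd_power_fps m) = (1 - s) ^ ((n - m) div 2) * P_lpk m s"
proof -
  have "\<Phi> (odd_power_fps m) = (\<Sum>p | p permutes {1..m}. \<Phi> (enriched_fps_odd m p))"
    by (simp only: odd_power_fps_eq_sum fps_functional.linear_sum[OF linear])
  also have "\<dots> = (\<Sum>p | p permutes {1..m}. (1 - s) ^ ((n - m) div 2) * s ^ lpk m p)"
    using assms by (intro sum.cong refl enriched_fps_odd) (auto dest: permutes_inj)
  finally show ?thesis by (simp add: P_lpk_def sum_distrib_left)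
qed

end

lemma ex_left_peak_functional:
  fixes s :: "'a::field_char_0"
  obtains \<Phi> where "left_peak_functional \<Phi> n s"
proof -
  obtain \<Phi> where "linear_functional \<Phi>" "\<And>i. i \<le> n \<Longrightarrow> \<Phi> (delannoy_fps i) = (1 - s) ^ ((n - i) div 2)"
    using ex_linear_functional_delannoy[of n "\<lambda>i. (1 - s) ^ ((n - i) div 2)"] by blast
  thus ?thesis using that[OF left_peak_functional.intro] by blast
qed

lemma sum_enriched_fps_odd_mult_inv:
  "(\<Sum>p | p permutes {1..n}.
      fps_nth (enriched_fps_odd n p) k * fps_nth (enriched_fps_odd n (inv p)) l) =
     (\<Sum>m\<le>n. kernel_coeff 1 n m *
      of_nat (2 * k + 1) ^ m * (of_nat (2 * l + 1) :: 'a::field_char_0) ^ m)"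
proof -
  have product: "(2 * k + 1) * (2 * l + 1) = 2 * (2 * k * l + k + l) + 1"
    by (simp add: algebra_simps)
  have "(\<Sum>p | p permutes {1..n}.
        fps_nth (enriched_fps_odd n p) k * fps_nth (enriched_fps_odd n (inv p)) l) =
      (of_nat (card (left_enriched n id ((2 * k + 1) * (2 * l + 1)))) :: 'a)"
    by (subst sum_card_left_enriched_mult_inv[symmetric]) (simp_all add: enriched_fps_odd_def)
  also have "\<dots> = fps_nth (enriched_fps_odd n id) (2 * k * l + k + l)"
    by (simp only: product enriched_fps_odd_def fps_nth_Abs_fps)
  also have "\<dots> = (\<Sum>m\<le>n. kernel_coeff 1 n m * of_nat ((2 * k + 1) * (2 * l + 1)) ^ m)"
    by (simp only: enriched_fps_odd_id fps_nth_delannoy_fps delannoy_eq_sum_kernel_coeff product)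
  finally show ?thesis by (simp only: of_nat_mult power_mult_distrib mult.assoc)
qed

lemma left_peak_functionals_kernel_term:
  assumes "left_peak_functional \<Phi> n s" "left_peak_functional \<Psi> n t"
    and r: "r ^ 2 = (1 - s) * (1 - t)" and "m \<le> n"
  shows "\<Phi> (fps_const (kernel_coeff 1 n m) * odd_power_fps m) * \<Psi> (odd_power_fps m) =
    P_lpk m s * P_lpk m t * kernel_coeff r n m"
proof -
  interpret s: left_peak_functional \<Phi> n s by fact
  interpret t: left_peak_functional \<Psi> n t by fact
  show ?thesis
  proof (cases "even (n - m)")
    case True
    hence "kernel_coeff r n m =
        (1 - s) ^ ((n - m) div 2) * (1 - t) ^ ((n - m) div 2) * kernel_coeff 1 n m"
      using kernel_coeff_scale[of r n m] \<open>m \<le> n\<close>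
      by (simp only: r power_mult_distrib simp_thms if_True)
    thus ?thesis
      unfolding fps_functional.linear_scale[OF s.linear]
        s.odd_power_fps[OF \<open>m \<le> n\<close> True] t.odd_power_fps[OF \<open>m \<le> n\<close> True]
      by (simp only: mult_ac)
  next
    case False
    hence "kernel_coeff c n m = 0" for c :: 'a by (subst kernel_coeff_scale) simp
    thus ?thesis by (simp add: fps_functional.linear_0[OF s.linear])
  qed
qed

lemma P_lpk_ilpk_eq_sum_kernel_coeff:
  fixes s t r :: "'a::field_char_0"
  assumes "r ^ 2 = (1 - s) * (1 - t)"
  shows "P_lpk_ilpk n s t = (\<Sum>m\<le>n. P_lpk m s * P_lpk m t * kernel_coeff r n m)"
proof -
  obtain \<Phi> \<Psi> where functionals: "left_peak_functional \<Phi> n s" "left_peak_functional \<Psi> n t"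
    using ex_left_peak_functional by metis
  interpret s: left_peak_functional \<Phi> n s by fact
  interpret t: left_peak_functional \<Psi> n t by fact
  have "P_lpk_ilpk n s t =
      (\<Sum>p | p permutes {1..n}. \<Phi> (enriched_fps_odd n p) * \<Psi> (enriched_fps_odd n (inv p)))"
    unfolding P_lpk_ilpk_def ilpk_def
  proof (rule sum.cong[OF refl])
    fix p assume "p \<in> {p. p permutes {1..n}}"
    hence "inj p" "inj (inv p)" by (auto intro: permutes_inj permutes_inv)
    thus "s ^ lpk n p * t ^ lpk n (inv p) =
        \<Phi> (enriched_fps_odd n p) * \<Psi> (enriched_fps_odd n (inv p))"
      by (simp add: s.enriched_fps_odd t.enriched_fps_odd)
  qed
  also have "\<dots> = (\<Sum>m\<le>n. \<Phi> (fps_const (kernel_coeff 1 n m) * odd_power_fps m) * \<Psi> (odd_power_fps m))"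
    by (rule linear_functional_tensor_cong[OF s.linear t.linear])
       (simp add: sum_enriched_fps_odd_mult_inv odd_power_fps_def del: One_nat_def)
  also have "\<dots> = (\<Sum>m\<le>n. P_lpk m s * P_lpk m t * kernel_coeff r n m)"
    using left_peak_functionals_kernel_term[OF functionals assms] by simp
  finally show ?thesis .
qed

definition P_lpk_exp_fps :: "'a::field_char_0 \<Rightarrow> 'a \<Rightarrow> 'a fps" where
  "P_lpk_exp_fps s t = Abs_fps (\<lambda>k. P_lpk k s * P_lpk k t / fact k)"

lemma fps_nth_L_quot_0 [simp]: "fps_nth (L_quot r) 0 = 0"
  by (simp add: L_quot_nth)

lemma P_lpk_exp_fps_compose_sums:
  "(\<lambda>k. fps_const (1 / fact k) * L_quot r ^ k * fps_const (P_lpk k s * P_lpk k t))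
     sums (P_lpk_exp_fps s t oo L_quot r)"
proof -
  have "fps_const (fps_nth (P_lpk_exp_fps s t) k) * L_quot r ^ k =
      fps_const (1 / fact k) * L_quot r ^ k * fps_const (P_lpk k s * P_lpk k t)" for k
  proof -
    have "fps_const (fps_nth (P_lpk_exp_fps s t) k) =
        fps_const (1 / fact k) * fps_const (P_lpk k s * P_lpk k t)"
      by (simp add: P_lpk_exp_fps_def)
    thus ?thesis by (simp only: mult_ac)
  qed
  thus ?thesis
    using fps_compose_sums[OF fps_nth_L_quot_0, of "P_lpk_exp_fps s t" r] by (simp only:)
qed

lemma P_lpk_ilpk_fps_eq_compose:
  fixes s t r :: "'a::field_char_0"
  assumes "r ^ 2 = (1 - s) * (1 - t)"
  shows "Abs_fps (\<lambda>n. P_lpk_ilpk n s t) =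
    inverse (fps_sqrt1 (1 - fps_const (r ^ 2) * fps_X ^ 2)) * (P_lpk_exp_fps s t oo L_quot r)"
    (is "_ = ?R")
proof (rule fps_ext)
  fix n
  have "fps_nth ?R n = P_lpk_ilpk n s t"
    unfolding fps_nth_mult_compose[OF fps_nth_L_quot_0] P_lpk_ilpk_eq_sum_kernel_coeff[OF assms]
    by (simp add: kernel_coeff_def P_lpk_exp_fps_def)
  thus "fps_nth (Abs_fps (\<lambda>n. P_lpk_ilpk n s t)) n = fps_nth ?R n" by simp
qed

theorem theorem4p5:
  fixes s t r :: "'a::field_char_0"
  assumes "r ^ 2 = (1 - s) * (1 - t)"
  shows "summable (\<lambda>k. fps_const (1 / fact k) * L_quot r ^ k
                        * fps_const (P_lpk k s * P_lpk k t)) \<and>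
         Abs_fps (\<lambda>n. P_lpk_ilpk n s t) =
           1 / fps_sqrt1 (1 - fps_const ((1 - s) * (1 - t)) * fps_X ^ 2)
           * (\<Sum>k. fps_const (1 / fact k) * L_quot r ^ k
                    * fps_const (P_lpk k s * P_lpk k t))"
proof -
  let ?Q = "fps_sqrt1 (1 - fps_const ((1 - s) * (1 - t)) * fps_X ^ 2)"
  have "Abs_fps (\<lambda>n. P_lpk_ilpk n s t) = inverse ?Q * (P_lpk_exp_fps s t oo L_quot r)"
    using P_lpk_ilpk_fps_eq_compose[OF assms] by (simp only: assms)
  moreover have "1 / ?Q = inverse ?Q" by (simp add: fps_divide_unit)
  ultimately show ?thesis
    using P_lpk_exp_fps_compose_sums[of r s t] by (simp only: sums_iff)
qed

end
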